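(* Let $B\subset\mathbb{R}$ be a densely ordered subset, let $E$ be a Kolmogorov space over $B$ (with complex Banach spaces as fibres), and let $\lambda:\Delta\to\mathbb{R}_{>0}$ be a submultiplicative weight function. Let $f=\sum_{n\ge0}a_nz^n\in\mathbb{C}\{z\}$ be a convergent power series with radius of convergence $R$. Then there is a well-defined map of Banach spaces over $\Delta\subset\mathbb{R}^2$ (i.e. a map preserving the base point $(t,s)$), called the Borel map, $$\mathcal{B}f:\mathcal{X}(R)\to\mathrm{Hom}(E,E),\qquad (t,s,v)\mapsto\Bigl(t,s,\sum_{n\ge0}\frac{a_n}{n!}v^n\Bigr),$$ where the series, evaluated at $(t,s)$, converges in $\mathrm{Hom}(E_t,E_s)$; and for every $(t,s,u)\in\mathcal{X}(R)$ one has the estimate $$\|\mathcal{B}f(u)\|\le |f|\left(\frac{|u|}{\lambda(t,s)}\right),$$ where the left-hand side is the operator norm in $\mathrm{Hom}(E_t,E_s)$ and $|u|$ is the norm in $\mathcal{L}^1(E,E)_{t,s}$.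
   Context: For $f=\sum a_nz^n$, $|f|$ denotes the power series $\sum|a_n|z^n$. An ordered set $B$ is viewed as a category with one morphism $a\to b$ exactly when $a\ge b$. A Kolmogorov space $E$ over $B$ is a functor from $B$ to Banach spaces (with continuous linear maps): Banach spaces $E_b$, $b\in B$, and continuous linear connecting maps $\iota_{ba}:E_a\to E_b$ for $a\ge b$, with $\iota_{aa}=\mathrm{Id}$, $\iota_{cb}\iota_{ba}=\iota_{ca}$ for $a\ge b\ge c$, and operator norms $\|\iota_{ba}\|\le1$. $\mathrm{Hom}(E,E)$ is the family over pairs $(t,s)$ of the Banach spaces $\mathrm{Hom}(E_t,E_s)$ of continuous linear maps with the operator norm. Put $\Delta=\{(t,s)\in B\times B:t>s\}$ and $\Delta(t,s)=\{(t',s')\in\Delta:t'\le t,\ s'\ge s\}$. A weight function is a function $\mu:\Delta\to\mathbb{R}_{>0}$. A horizontal section $u$ of $\mathrm{Hom}(E,E)$ over $A\subset\Delta$ is a family of continuous linear maps $u_{t',s'}:E_{t'}\to E_{s'}$, $(t',s')\in A$, with $u_{t'',s''}=\iota_{s''s'}\circ u_{t',s'}\circ\iota_{t't''}$ whenever $(t',s'),(t'',s'')\in A$, $t''\ge t'$ and $s'\ge s''$. For a weight function $\mu$, $\mathcal{L}^{\mu}(E,E)_{t,s}$ is the Banach space of horizontal sections $u$ over $\Delta(t,s)$ with $|u|:=\sup_{(t',s')\in\Delta(t,s)}\mu(t',s')\|u_{t',s'}\|<\infty$. Composition of horizontal sections over $\Delta(t,s)$ is $(v\circ u)_{t',s'}=v_{r,s'}\circ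 u_{t',r}$ for any $r\in B$ with $t'>r>s'$ (independent of $r$); $v^n$ is the $n$-fold composition of $v$, and $v^0$ is the section $(t',s')\mapsto\iota_{s't'}$. The sum $\sum\frac{a_n}{n!}v^n$ is evaluated at $(t,s)$, i.e. it is $\sum\frac{a_n}{n!}(v^n)_{t,s}$. A weight function $\lambda$ is submultiplicative if, with $\lambda_n(t,s):=\dfrac{e^n\lambda(t,s)^n}{n^n}$ for $n\ge1$, for all $p,q\ge1$ and all $(t,s)\in\Delta$ there exists $m\in B$ with $s<m<t$ and $\lambda_{p+q}(t,s)\le\lambda_p(t,m)\lambda_q(m,s)$. Write $\mathcal{L}^k(E,E)=\mathcal{L}^{\lambda_k}(E,E)$; in particular the norm of $\mathcal{L}^1(E,E)_{t,s}$ is defined with the weight $\lambda_1=e\lambda$. Finally $$\mathcal{X}(R)=\{(t,s,u): (t,s)\in\Delta,\ u\in\mathcal{L}^1(E,E)_{t,s},\ |u|<R\,\lambda(t,s)\}.$$ *)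

theory Defs
  imports "HOL-Analysis.Analysis" "HOL-Algebra.Module"
begin

text \<open>
  The fibres of a Kolmogorov space are different Banach spaces, so they are given by explicit
  carriers and operations. All carriers live in one type \<open>'a\<close>; any family of Banach spaces can be
  arranged this way. The ring-multiplication fields that a module record inherits play no role.
\<close>

record 'a cnormed = "(complex, 'a) module" +
  vnorm :: "'a \<Rightarrow> real"

definition complex_field :: "complex ring" where
  "complex_field = \<lparr>carrier = UNIV, mult = (*), one = 1, zero = 0, add = (+)\<rparr>"

text \<open>
  The value outside the carrier only serves to make \<open>vdist V\<close> globally symmetric and nonnegative,
  as required by the locale of metric spaces.
\<close>

definition vdist :: "'a cnormed \<Rightarrow> 'a \<Rightarrow> 'a \<Rightarrow> real" where
  "vdist V x y =
    (if x \<in> carrier V \<and> y \<in> carrier V then vnorm V (x \<ominus>\<^bsub>V\<^esub> y) else 0)"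

abbreviation vtopology :: "'a cnormed \<Rightarrow> 'a topology" where
  "vtopology V \<equiv> Metric_space.mtopology (carrier V) (vdist V)"

locale complex_normed_space =
  fixes V :: "'a cnormed"
  assumes vector_space: "Module.module complex_field V"
    and vnorm_eq_zero_iff: "x \<in> carrier V \<Longrightarrow> vnorm V x = 0 \<longleftrightarrow> x = \<zero>\<^bsub>V\<^esub>"
    and vnorm_triangle:
      "\<lbrakk>x \<in> carrier V; y \<in> carrier V\<rbrakk> \<Longrightarrow> vnorm V (x \<oplus>\<^bsub>V\<^esub> y) \<le> vnorm V x + vnorm V y"
    and vnorm_smult: "x \<in> carrier V \<Longrightarrow> vnorm V (c \<odot>\<^bsub>V\<^esub> x) = cmod c * vnorm V x"

locale complex_banach_space = complex_normed_space +
  assumes complete: "Metric_space.mcomplete (carrier V) (vdist V)"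

definition vsums :: "'a cnormed \<Rightarrow> (nat \<Rightarrow> 'a) \<Rightarrow> 'a \<Rightarrow> bool" where
  "vsums V g w \<longleftrightarrow> range g \<subseteq> carrier V \<and>
    limitin (vtopology V) (\<lambda>N. finsum V g {..<N}) w sequentially"

definition vsuminf :: "'a cnormed \<Rightarrow> (nat \<Rightarrow> 'a) \<Rightarrow> 'a" where
  "vsuminf V g = (THE w. vsums V g w)"

text \<open>
  Maps between carriers are extensional (\<open>undefined\<close> off the domain), so that equality of maps in
  the logic is equality on the domain.
\<close>

definition continuous_linear_maps :: "'a cnormed \<Rightarrow> 'b cnormed \<Rightarrow> ('a \<Rightarrow> 'b) set" where
  "continuous_linear_maps V W = {h \<in> carrier V \<rightarrow>\<^sub>E carrier W.
     (\<forall>x\<in>carrier V. \<forall>y\<in>carrier V. h (x \<oplus>\<^bsub>V\<^esub> y) = h x \<oplus>\<^bsub>W\<^esub> h y) \<and>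
     (\<forall>c. \<forall>x\<in>carrier V. h (c \<odot>\<^bsub>V\<^esub> x) = c \<odot>\<^bsub>W\<^esub> h x) \<and>
     continuous_map (vtopology V) (vtopology W) h}"

definition Hom :: "'a cnormed \<Rightarrow> 'b cnormed \<Rightarrow> ('a \<Rightarrow> 'b) cnormed" where
  "Hom V W = \<lparr>carrier = continuous_linear_maps V W,
     mult = undefined, one = undefined,
     zero = (\<lambda>x\<in>carrier V. \<zero>\<^bsub>W\<^esub>),
     add = (\<lambda>g h. \<lambda>x\<in>carrier V. g x \<oplus>\<^bsub>W\<^esub> h x),
     smult = (\<lambda>c h. \<lambda>x\<in>carrier V. c \<odot>\<^bsub>W\<^esub> h x),
     vnorm = (\<lambda>h. SUP x\<in>{x \<in> carrier V. vnorm V x \<le> 1}. vnorm W (h x))\<rparr>"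

definition densely_ordered :: "real set \<Rightarrow> bool" where
  "densely_ordered B \<longleftrightarrow> (\<forall>x\<in>B. \<forall>y\<in>B. x < y \<longrightarrow> (\<exists>z\<in>B. x < z \<and> z < y))"

text \<open>The connecting map \<open>\<iota> b a\<close> goes from \<open>E a\<close> to \<open>E b\<close>, for \<open>a \<ge> b\<close>.\<close>

locale kolmogorov_space =
  fixes B :: "real set"
    and E :: "real \<Rightarrow> 'a cnormed"
    and \<iota> :: "real \<Rightarrow> real \<Rightarrow> 'a \<Rightarrow> 'a"
  assumes banach: "b \<in> B \<Longrightarrow> complex_banach_space (E b)"
    and connecting: "\<lbrakk>a \<in> B; b \<in> B; a \<ge> b\<rbrakk> \<Longrightarrow> \<iota> b a \<in> carrier (Hom (E a) (E b))"
    and connecting_refl: "a \<in> B \<Longrightarrow> \<iota> a a = (\<lambda>x\<in>carrier (E a). x)"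
    and connecting_comp:
      "\<lbrakk>a \<in> B; b \<in> B; c \<in> B; a \<ge> b; b \<ge> c\<rbrakk>
        \<Longrightarrow> compose (carrier (E a)) (\<iota> c b) (\<iota> b a) = \<iota> c a"
    and connecting_norm:
      "\<lbrakk>a \<in> B; b \<in> B; a \<ge> b\<rbrakk> \<Longrightarrow> vnorm (Hom (E a) (E b)) (\<iota> b a) \<le> 1"

definition Delta :: "real set \<Rightarrow> (real \<times> real) set" where
  "Delta B = {(t, s). t \<in> B \<and> s \<in> B \<and> t > s}"

definition Delta_at :: "real set \<Rightarrow> real \<times> real \<Rightarrow> (real \<times> real) set" where
  "Delta_at B = (\<lambda>(t, s). {(t', s') \<in> Delta B. t' \<le> t \<and> s' \<ge> s})"

definition weight_function :: "real set \<Rightarrow> (real \<times> real \<Rightarrow> real) \<Rightarrow> bool" where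
  "weight_function B \<mu> \<longleftrightarrow> (\<forall>p\<in>Delta B. \<mu> p > 0)"

definition weight_power :: "(real \<times> real \<Rightarrow> real) \<Rightarrow> nat \<Rightarrow> real \<times> real \<Rightarrow> real" where
  "weight_power \<mu> n p = exp 1 ^ n * \<mu> p ^ n / real n ^ n"

definition submultiplicative :: "real set \<Rightarrow> (real \<times> real \<Rightarrow> real) \<Rightarrow> bool" where
  "submultiplicative B \<mu> \<longleftrightarrow>
    (\<forall>p\<ge>1. \<forall>q\<ge>1. \<forall>(t, s)\<in>Delta B. \<exists>m\<in>B. s < m \<and> m < t \<and>
      weight_power \<mu> (p + q) (t, s) \<le> weight_power \<mu> p (t, m) * weight_power \<mu> q (m, s))"

type_synonym 'a hsection = "real \<times> real \<Rightarrow> 'a \<Rightarrow> 'a"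

definition horizontal_sections ::
    "(real \<Rightarrow> 'a cnormed) \<Rightarrow> (real \<Rightarrow> real \<Rightarrow> 'a \<Rightarrow> 'a) \<Rightarrow> (real \<times> real) set \<Rightarrow> 'a hsection set"
  where
  "horizontal_sections E \<iota> A =
    {u \<in> (\<Pi>\<^sub>E (t, s)\<in>A. carrier (Hom (E t) (E s))).
      \<forall>(t', s')\<in>A. \<forall>(t'', s'')\<in>A. t'' \<ge> t' \<and> s' \<ge> s'' \<longrightarrow>
        u (t'', s'') =
          compose (carrier (E t'')) (\<iota> s'' s') (compose (carrier (E t'')) (u (t', s')) (\<iota> t' t''))}"

definition Lspace ::
    "real set \<Rightarrow> (real \<Rightarrow> 'a cnormed) \<Rightarrow> (real \<Rightarrow> real \<Rightarrow> 'a \<Rightarrow> 'a) \<Rightarrow>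
      (real \<times> real \<Rightarrow> real) \<Rightarrow> real \<times> real \<Rightarrow> 'a hsection cnormed"
  where
  "Lspace B E \<iota> \<mu> p = \<lparr>
     carrier = {u \<in> horizontal_sections E \<iota> (Delta_at B p).
       bdd_above ((\<lambda>(t', s'). \<mu> (t', s') * vnorm (Hom (E t') (E s')) (u (t', s'))) ` Delta_at B p)},
     mult = undefined, one = undefined,
     zero = (\<lambda>(t', s')\<in>Delta_at B p. \<zero>\<^bsub>Hom (E t') (E s')\<^esub>),
     add = (\<lambda>u v. \<lambda>(t', s')\<in>Delta_at B p. u (t', s') \<oplus>\<^bsub>Hom (E t') (E s')\<^esub> v (t', s')),
     smult = (\<lambda>c u. \<lambda>(t', s')\<in>Delta_at B p. c \<odot>\<^bsub>Hom (E t') (E s')\<^esub> u (t', s')),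
     vnorm = (\<lambda>u. SUP (t', s')\<in>Delta_at B p.
       \<mu> (t', s') * vnorm (Hom (E t') (E s')) (u (t', s')))\<rparr>"

text \<open>
  The composite is the common value over all admissible intermediate points \<open>r\<close>: the definite
  description is meaningful only because this value does not depend on \<open>r\<close>.
\<close>

definition section_comp ::
    "real set \<Rightarrow> (real \<Rightarrow> 'a cnormed) \<Rightarrow> real \<times> real \<Rightarrow>
      'a hsection \<Rightarrow> 'a hsection \<Rightarrow> 'a hsection"
  where
  "section_comp B E p v u = (\<lambda>(t', s')\<in>Delta_at B p.
     THE w. \<forall>r\<in>B. t' > r \<and> r > s' \<longrightarrow>
       w = compose (carrier (E t')) (v (r, s')) (u (t', r)))"

fun section_power ::
    "real set \<Rightarrow> (real \<Rightarrow> 'a cnormed) \<Rightarrow> (real \<Rightarrow> real \<Rightarrow> 'a \<Rightarrow> 'a) \<Rightarrow> real \<times> real \<Rightarrow>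
      'a hsection \<Rightarrow> nat \<Rightarrow> 'a hsection"
  where
  "section_power B E \<iota> p v 0 = (\<lambda>(t', s')\<in>Delta_at B p. \<iota> s' t')"
| "section_power B E \<iota> p v (Suc 0) = v"
| "section_power B E \<iota> p v (Suc (Suc n)) =
     section_comp B E p v (section_power B E \<iota> p v (Suc n))"

text \<open>The radius \<open>R\<close> may be \<open>\<infinity>\<close>, hence the extended reals.\<close>

definition borel_domain ::
    "real set \<Rightarrow> (real \<Rightarrow> 'a cnormed) \<Rightarrow> (real \<Rightarrow> real \<Rightarrow> 'a \<Rightarrow> 'a) \<Rightarrow>
      (real \<times> real \<Rightarrow> real) \<Rightarrow> ereal \<Rightarrow> (real \<times> real \<times> 'a hsection) set"
  where
  "borel_domain B E \<iota> \<mu> R = {(t, s, u). (t, s) \<in> Delta B \<and>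
     u \<in> carrier (Lspace B E \<iota> (weight_power \<mu> 1) (t, s)) \<and>
     ereal (vnorm (Lspace B E \<iota> (weight_power \<mu> 1) (t, s)) u) < R * ereal (\<mu> (t, s))}"

definition Hom_bundle ::
    "real set \<Rightarrow> (real \<Rightarrow> 'a cnormed) \<Rightarrow> (real \<times> real \<times> ('a \<Rightarrow> 'a)) set" where
  "Hom_bundle B E = {(t, s, h). (t, s) \<in> Delta B \<and> h \<in> carrier (Hom (E t) (E s))}"

definition borel_term ::
    "real set \<Rightarrow> (real \<Rightarrow> 'a cnormed) \<Rightarrow> (real \<Rightarrow> real \<Rightarrow> 'a \<Rightarrow> 'a) \<Rightarrow> complex fps \<Rightarrow>
      real \<times> real \<times> 'a hsection \<Rightarrow> nat \<Rightarrow> 'a \<Rightarrow> 'a"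
  where
  "borel_term B E \<iota> f = (\<lambda>(t, s, v) n.
     (fps_nth f n / fact n) \<odot>\<^bsub>Hom (E t) (E s)\<^esub> section_power B E \<iota> (t, s) v n (t, s))"

definition borel_map ::
    "real set \<Rightarrow> (real \<Rightarrow> 'a cnormed) \<Rightarrow> (real \<Rightarrow> real \<Rightarrow> 'a \<Rightarrow> 'a) \<Rightarrow> complex fps \<Rightarrow>
      real \<times> real \<times> 'a hsection \<Rightarrow> real \<times> real \<times> ('a \<Rightarrow> 'a)"
  where
  "borel_map B E \<iota> f =
    (\<lambda>(t, s, v). (t, s, vsuminf (Hom (E t) (E s)) (borel_term B E \<iota> f (t, s, v))))"

definition fps_abs :: "complex fps \<Rightarrow> real fps" where
  "fps_abs f = Abs_fps (\<lambda>n. cmod (fps_nth f n))"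

end

theory Submission
  imports Defs
begin

text \<open>
  Iterating the submultiplicativity inequality with \<open>q = 1\<close> gives
  \<open>\<lambda>\<^sub>n(t, s) \<parallel>(v\<^sup>n)\<^sub>t\<^sub>s\<parallel> \<le> |v|\<^sup>n\<close>: at each step \<open>v\<^sup>n\<^sup>+\<^sup>1\<close> is factored through the point \<open>m\<close> that
  submultiplicativity provides. Since \<open>n\<^sup>n \<le> e\<^sup>n n!\<close>, the factor \<open>1/n!\<close> of the Borel transform absorbs
  the weight, and the series is dominated termwise by \<open>\<Sum> |a\<^sub>n| (|v|/\<lambda>)\<^sup>n\<close>. It converges because
  \<open>Hom(E\<^sub>t, E\<^sub>s)\<close> is complete.
\<close>

section \<open>Complex normed spaces with explicit carriers\<close>

text \<open>The factor \<open>e^n / n^n\<close> in the weights can be read off from the model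
  \<lambda>(t, s) = t - s: if m divides the interval from s to t so that t - m and m - s are in the
  ratio p : q, submultiplicativity holds with equality. The good point m thus depends on the
  exponents and on the pair (t, s). Powers can be estimated all the same, because a composite of
  horizontal sections may be computed through any intermediate point, a different one for each
  exponent and each pair. The fibres are unrelated Banach spaces that merely share a type, so a
  norm, its topology and its series cannot be attached to that type. The comparison test, the
  operator norm and the completeness of \<open>Hom\<close> are therefore developed for spaces with
  an explicit carrier.\<close>

context complex_normed_space
begin

sublocale VS: Module.module complex_field V
  by (rule vector_space)

lemma smult_in [simp, intro]: "x \<in> carrier V \<Longrightarrow> c \<odot>\<^bsub>V\<^esub> x \<in> carrier V"
  using VS.smult_closed[of c x] by (simp add: complex_field_def)

lemma smult_add_left: "x \<in> carrier V \<Longrightarrow> (c + d) \<odot>\<^bsub>V\<^esub> x = c \<odot>\<^bsub>V\<^esub> x \<oplus>\<^bsub>V\<^esub> d \<odot>\<^bsub>V\<^esub> x"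
  using VS.smult_l_distr[of c d x] by (simp add: complex_field_def)

lemma smult_add_right:
  "\<lbrakk>x \<in> carrier V; y \<in> carrier V\<rbrakk> \<Longrightarrow> c \<odot>\<^bsub>V\<^esub> (x \<oplus>\<^bsub>V\<^esub> y) = c \<odot>\<^bsub>V\<^esub> x \<oplus>\<^bsub>V\<^esub> c \<odot>\<^bsub>V\<^esub> y"
  using VS.smult_r_distr[of c x y] by (simp add: complex_field_def)

lemma smult_smult: "x \<in> carrier V \<Longrightarrow> c \<odot>\<^bsub>V\<^esub> (d \<odot>\<^bsub>V\<^esub> x) = (c * d) \<odot>\<^bsub>V\<^esub> x"
  using VS.smult_assoc1[of c d x] by (simp add: complex_field_def)

lemma smult_1 [simp]: "x \<in> carrier V \<Longrightarrow> 1 \<odot>\<^bsub>V\<^esub> x = x"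
  using VS.smult_one[of x] by (simp add: complex_field_def)

lemma smult_0_left [simp]: "x \<in> carrier V \<Longrightarrow> 0 \<odot>\<^bsub>V\<^esub> x = \<zero>\<^bsub>V\<^esub>"
  using VS.smult_l_null[of x] by (simp add: complex_field_def)

lemma smult_0_right [simp]: "c \<odot>\<^bsub>V\<^esub> \<zero>\<^bsub>V\<^esub> = \<zero>\<^bsub>V\<^esub>"
  using VS.smult_r_null[of c] by (simp add: complex_field_def)

lemma minus_eq_smult: "x \<in> carrier V \<Longrightarrow> \<ominus>\<^bsub>V\<^esub> x = (-1) \<odot>\<^bsub>V\<^esub> x"
  using smult_add_left[of x "-1" 1] by (intro VS.M.minus_equality) auto

lemma diff_eq_smult: "x \<ominus>\<^bsub>V\<^esub> y = x \<oplus>\<^bsub>V\<^esub> (-1) \<odot>\<^bsub>V\<^esub> y" if "y \<in> carrier V"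
  using that by (simp add: a_minus_def minus_eq_smult)

lemma vnorm_0 [simp]: "vnorm V \<zero>\<^bsub>V\<^esub> = 0"
  by (simp add: vnorm_eq_zero_iff)

lemma vnorm_minus [simp]: "x \<in> carrier V \<Longrightarrow> vnorm V (\<ominus>\<^bsub>V\<^esub> x) = vnorm V x"
  by (simp add: minus_eq_smult vnorm_smult)

lemma vnorm_nonneg: "x \<in> carrier V \<Longrightarrow> vnorm V x \<ge> 0"
  using vnorm_triangle[of x "\<ominus>\<^bsub>V\<^esub> x"] by (simp add: VS.M.r_neg)

lemma vnorm_diff_commute:
  assumes "x \<in> carrier V" "y \<in> carrier V"
  shows "vnorm V (x \<ominus>\<^bsub>V\<^esub> y) = vnorm V (y \<ominus>\<^bsub>V\<^esub> x)"
proof -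
  have "x \<ominus>\<^bsub>V\<^esub> y = \<ominus>\<^bsub>V\<^esub> (y \<ominus>\<^bsub>V\<^esub> x)"
    using assms by (simp add: a_minus_def VS.M.minus_add VS.M.a_comm)
  then show ?thesis
    using assms by simp
qed

lemma vnorm_diff_triangle:
  assumes "x \<in> carrier V" "y \<in> carrier V" "z \<in> carrier V"
  shows "vnorm V (x \<ominus>\<^bsub>V\<^esub> z) \<le> vnorm V (x \<ominus>\<^bsub>V\<^esub> y) + vnorm V (y \<ominus>\<^bsub>V\<^esub> z)"
proof -
  have "x \<ominus>\<^bsub>V\<^esub> z = (x \<ominus>\<^bsub>V\<^esub> y) \<oplus>\<^bsub>V\<^esub> (y \<ominus>\<^bsub>V\<^esub> z)"
    using assms by (simp add: a_minus_def VS.M.a_assoc VS.M.r_neg1)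
  then show ?thesis
    using assms vnorm_triangle[of "x \<ominus>\<^bsub>V\<^esub> y" "y \<ominus>\<^bsub>V\<^esub> z"] by simp
qed

section \<open>The metric of a norm and its limits\<close>

lemma vdist_eq [simp]:
  "\<lbrakk>x \<in> carrier V; y \<in> carrier V\<rbrakk> \<Longrightarrow> vdist V x y = vnorm V (x \<ominus>\<^bsub>V\<^esub> y)"
  by (simp add: vdist_def)

lemma Metric_space_vdist: "Metric_space (carrier V) (vdist V)"
proof
  show "vdist V x y \<ge> 0" for x y
    by (simp add: vdist_def vnorm_nonneg)
  show "vdist V x y = vdist V y x" for x y
    by (simp add: vdist_def vnorm_diff_commute)
  show "vdist V x y = 0 \<longleftrightarrow> x = y" if "x \<in> carrier V" "y \<in> carrier V" for x y
  proof -
    have "x \<ominus>\<^bsub>V\<^esub> y = \<zero>\<^bsub>V\<^esub> \<longleftrightarrow> x = y"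
      using that
      by (metis VS.M.a_inv_closed VS.M.minus_equality VS.M.minus_minus VS.M.r_neg a_minus_def)
    with that show ?thesis
      by (simp add: vnorm_eq_zero_iff)
  qed
  show "vdist V x z \<le> vdist V x y + vdist V y z"
    if "x \<in> carrier V" "y \<in> carrier V" "z \<in> carrier V" for x y z
    using that vnorm_diff_triangle by simp
qed

sublocale VM: Metric_space "carrier V" "vdist V"
  by (rule Metric_space_vdist)

lemma limitin_add:
  assumes a: "limitin (vtopology V) a x sequentially"
    and b: "limitin (vtopology V) b y sequentially"
    and in_V: "range a \<subseteq> carrier V" "range b \<subseteq> carrier V"
  shows "limitin (vtopology V) (\<lambda>n. a n \<oplus>\<^bsub>V\<^esub> b n) (x \<oplus>\<^bsub>V\<^esub> y) sequentially"
proof -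
  have V: "x \<in> carrier V" "y \<in> carrier V" "\<And>n. a n \<in> carrier V" "\<And>n. b n \<in> carrier V"
    using a b in_V by (auto simp: VM.limitin_metric)
  have *: "vdist V (a n \<oplus>\<^bsub>V\<^esub> b n) (x \<oplus>\<^bsub>V\<^esub> y) \<le> vdist V (a n) x + vdist V (b n) y" for n
  proof -
    have "(a n \<oplus>\<^bsub>V\<^esub> b n) \<ominus>\<^bsub>V\<^esub> (x \<oplus>\<^bsub>V\<^esub> y) = (a n \<ominus>\<^bsub>V\<^esub> x) \<oplus>\<^bsub>V\<^esub> (b n \<ominus>\<^bsub>V\<^esub> y)"
      using V by (simp add: a_minus_def VS.M.minus_add VS.M.a_ac)
    then show ?thesis
      using V vnorm_triangle[of "a n \<ominus>\<^bsub>V\<^esub> x" "b n \<ominus>\<^bsub>V\<^esub> y"] by simp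
  qed
  have "(\<lambda>n. vdist V (a n) x + vdist V (b n) y) \<longlonglongrightarrow> 0"
    using a b by (intro tendsto_add_zero) (auto simp: VM.limitin_metric_dist_null)
  then have lim: "(\<lambda>n. vdist V (a n \<oplus>\<^bsub>V\<^esub> b n) (x \<oplus>\<^bsub>V\<^esub> y)) \<longlonglongrightarrow> 0"
    by (rule Lim_null_comparison[rotated]) (simp add: * del: vdist_eq)
  then show ?thesis
    using V by (simp add: VM.limitin_metric_dist_null del: vdist_eq)
qed

lemma limitin_smult:
  assumes a: "limitin (vtopology V) a x sequentially" and in_V: "range a \<subseteq> carrier V"
  shows "limitin (vtopology V) (\<lambda>n. c \<odot>\<^bsub>V\<^esub> a n) (c \<odot>\<^bsub>V\<^esub> x) sequentially"
proof -
  have V: "x \<in> carrier V" "\<And>n. a n \<in> carrier V"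
    using a in_V by (auto simp: VM.limitin_metric)
  have "c \<odot>\<^bsub>V\<^esub> a n \<ominus>\<^bsub>V\<^esub> c \<odot>\<^bsub>V\<^esub> x = c \<odot>\<^bsub>V\<^esub> (a n \<ominus>\<^bsub>V\<^esub> x)" for n
    using V by (simp add: diff_eq_smult smult_add_right smult_smult)
  then have *: "vdist V (c \<odot>\<^bsub>V\<^esub> a n) (c \<odot>\<^bsub>V\<^esub> x) = cmod c * vdist V (a n) x" for n
    using V by (simp add: vnorm_smult)
  have "(\<lambda>n. cmod c * vdist V (a n) x) \<longlonglongrightarrow> cmod c * 0"
    using a by (intro tendsto_mult) (auto simp: VM.limitin_metric_dist_null)
  then show ?thesis
    using V by (simp add: VM.limitin_metric_dist_null * del: vdist_eq)
qed

text \<open>Closed balls are closed. A bound on a tail suffices, so that in a Cauchy estimate with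
  two large indices one of them can be sent to infinity.\<close>

lemma vnorm_limit_le:
  assumes "limitin (vtopology V) a x sequentially" and "range a \<subseteq> carrier V"
    and "y \<in> carrier V" and "\<And>n. n \<ge> N \<Longrightarrow> vnorm V (y \<ominus>\<^bsub>V\<^esub> a n) \<le> K"
  shows "vnorm V (y \<ominus>\<^bsub>V\<^esub> x) \<le> K"
proof -
  have V: "x \<in> carrier V" "\<And>n. a n \<in> carrier V" and lim: "(\<lambda>n. vdist V (a n) x) \<longlonglongrightarrow> 0"
    using assms by (auto simp: VM.limitin_metric_dist_null)
  have "(\<lambda>n. K + vdist V (a n) x) \<longlonglongrightarrow> K + 0"
    by (intro tendsto_add tendsto_const lim)
  moreover have "vnorm V (y \<ominus>\<^bsub>V\<^esub> x) \<le> K + vdist V (a n) x" if "n \<ge> N" for n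
    using vnorm_diff_triangle[of y "a n" x] assms(3) assms(4)[of n] V that by simp
  ultimately show ?thesis
    by (intro tendsto_lowerbound[where f = "\<lambda>n. K + vdist V (a n) x" and F = sequentially])
      (auto simp: eventually_sequentially simp del: vdist_eq)
qed

section \<open>Convergent series\<close>

lemma vsums_unique: "\<lbrakk>vsums V g x; vsums V g y\<rbrakk> \<Longrightarrow> x = y"
  unfolding vsums_def using VM.limitin_metric_unique trivial_limit_sequentially by metis

text \<open>Limits in a metric space are unique, so the definite description in
  \<open>vsuminf\<close> denotes as soon as one sum has been exhibited.\<close>

lemma vsums_vsuminf: "vsums V g w \<Longrightarrow> vsums V g (vsuminf V g) \<and> vsuminf V g = w"
  unfolding vsuminf_def by (metis the_equality vsums_unique)

lemma vnorm_finsum_diff_le: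
  assumes g: "range g \<subseteq> carrier V" and c: "\<And>n. vnorm V (g n) \<le> c n" and "N \<le> (M::nat)"
  shows "vnorm V (finsum V g {..<M} \<ominus>\<^bsub>V\<^esub> finsum V g {..<N}) \<le> sum c {N..<M}"
  using \<open>N \<le> M\<close>
proof (induction M rule: dec_induct)
  case base
  have "finsum V g {..<N} \<in> carrier V"
    using g by (intro VS.M.finsum_closed) auto
  then show ?case
    by (simp add: a_minus_def VS.M.r_neg)
next
  case (step M)
  have V: "finsum V g {..<k} \<in> carrier V" "g k \<in> carrier V" for k
    using g by (auto intro: VS.M.finsum_closed)
  have "finsum V g {..<Suc M} = g M \<oplus>\<^bsub>V\<^esub> finsum V g {..<M}"
    unfolding lessThan_Suc using g by (intro VS.M.finsum_insert) auto
  then have "finsum V g {..<Suc M} \<ominus>\<^bsub>V\<^esub> finsum V g {..<N}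
      = g M \<oplus>\<^bsub>V\<^esub> (finsum V g {..<M} \<ominus>\<^bsub>V\<^esub> finsum V g {..<N})"
    using V by (simp add: a_minus_def VS.M.a_assoc)
  then show ?case
    using vnorm_triangle[of "g M" "finsum V g {..<M} \<ominus>\<^bsub>V\<^esub> finsum V g {..<N}"] V c[of M] step
    by simp
qed

end

text \<open>The comparison test: blocks of the series are dominated by blocks of the majorant, so
  the partial sums are Cauchy, and their common bound \<open>suminf c\<close> passes to the
  limit.\<close>

lemma (in complex_banach_space) vsums_summable_bound:
  assumes g: "range g \<subseteq> carrier V" and c: "\<And>n. vnorm V (g n) \<le> c n" and "summable c"
  shows "\<exists>w. vsums V g w \<and> w \<in> carrier V \<and> vnorm V w \<le> suminf c"
proof -
  define S where "S N = finsum V g {..<N}" for N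
  have S: "S N \<in> carrier V" for N
    unfolding S_def using g by (intro VS.M.finsum_closed) auto
  have c0: "0 \<le> c n" for n
    using vnorm_nonneg[of "g n"] c[of n] g by fastforce
  have "VM.MCauchy S"
    unfolding VM.MCauchy_def
  proof (intro conjI allI impI)
    show "range S \<subseteq> carrier V"
      using S by auto
  next
    fix e :: real assume "e > 0"
    then obtain N where N: "\<And>m n. m \<ge> N \<Longrightarrow> norm (sum c {m..<n}) < e"
      using \<open>summable c\<close> unfolding summable_Cauchy by blast
    have "vdist V (S m) (S n) < e" if "N \<le> n" "n \<le> m" for m n
      using vnorm_finsum_diff_le[OF g c \<open>n \<le> m\<close>] N[OF \<open>N \<le> n\<close>, of m] S
      by (simp add: S_def[symmetric])
    then show "\<exists>N. \<forall>n n'. N \<le> n \<longrightarrow> N \<le> n' \<longrightarrow> vdist V (S n) (S n') < e"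
      by (metis VM.commute nle_le)
  qed
  then obtain w where w: "limitin (vtopology V) S w sequentially"
    using complete by (auto simp: VM.mcomplete_def)
  then have wV: "w \<in> carrier V"
    by (simp add: VM.limitin_metric)
  \<comment> \<open>The bound is phrased as a distance from the origin, the form in which
    \<open>vnorm_limit_le\<close> carries it over to the limit.\<close>
  have "vnorm V (\<zero>\<^bsub>V\<^esub> \<ominus>\<^bsub>V\<^esub> S n) \<le> suminf c" for n
  proof -
    have "vnorm V (S n \<ominus>\<^bsub>V\<^esub> S 0) \<le> sum c {..<n}"
      using vnorm_finsum_diff_le[OF g c, of 0 n] by (simp add: S_def lessThan_atLeast0)
    also have "S 0 = \<zero>\<^bsub>V\<^esub>"
      by (simp add: S_def)
    also have "sum c {..<n} \<le> suminf c"
      using \<open>summable c\<close> c0 by (intro sum_le_suminf) auto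
    finally show ?thesis
      using S by (simp add: vnorm_diff_commute)
  qed
  then have "vnorm V (\<zero>\<^bsub>V\<^esub> \<ominus>\<^bsub>V\<^esub> w) \<le> suminf c"
    using S by (intro vnorm_limit_le[OF w, of _ 0]) auto
  then have "vnorm V w \<le> suminf c"
    using wV by (simp add: a_minus_def)
  with w wV g show ?thesis
    unfolding vsums_def S_def by blast
qed

section \<open>Spaces of continuous linear maps\<close>

text \<open>These rules turn the algebra of \<open>Hom V W\<close> into pointwise formulas. Proofs
  that use it abstractly as a normed space switch them off.\<close>

lemma Hom_simps [simp]:
  "zero (Hom V W) = (\<lambda>x\<in>carrier V. \<zero>\<^bsub>W\<^esub>)"
  "g \<oplus>\<^bsub>Hom V W\<^esub> h = (\<lambda>x\<in>carrier V. g x \<oplus>\<^bsub>W\<^esub> h x)"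
  "c \<odot>\<^bsub>Hom V W\<^esub> h = (\<lambda>x\<in>carrier V. c \<odot>\<^bsub>W\<^esub> h x)"
  by (simp_all add: Hom_def)

locale complex_normed_space_pair =
  V: complex_normed_space V + W: complex_normed_space W
  for V :: "'a cnormed" and W :: "'b cnormed"
begin

text \<open>For linear maps continuity amounts to boundedness. The topological clause of
  \<open>continuous_linear_maps\<close> is traded here, once and for all, for a constant K.\<close>

lemma Hom_iff:
  "h \<in> carrier (Hom V W) \<longleftrightarrow> h \<in> carrier V \<rightarrow>\<^sub>E carrier W \<and>
     (\<forall>x\<in>carrier V. \<forall>y\<in>carrier V. h (x \<oplus>\<^bsub>V\<^esub> y) = h x \<oplus>\<^bsub>W\<^esub> h y) \<and>
     (\<forall>c. \<forall>x\<in>carrier V. h (c \<odot>\<^bsub>V\<^esub> x) = c \<odot>\<^bsub>W\<^esub> h x) \<and>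
     (\<exists>K\<ge>0. \<forall>x\<in>carrier V. vnorm W (h x) \<le> K * vnorm V x)"
proof -
  have "continuous_map (vtopology V) (vtopology W) h \<longleftrightarrow>
      (\<exists>K\<ge>0. \<forall>x\<in>carrier V. vnorm W (h x) \<le> K * vnorm V x)"
    if h: "h \<in> carrier V \<rightarrow>\<^sub>E carrier W"
      and add: "\<forall>x\<in>carrier V. \<forall>y\<in>carrier V. h (x \<oplus>\<^bsub>V\<^esub> y) = h x \<oplus>\<^bsub>W\<^esub> h y"
      and smult: "\<forall>c. \<forall>x\<in>carrier V. h (c \<odot>\<^bsub>V\<^esub> x) = c \<odot>\<^bsub>W\<^esub> h x"
  proof -
    have hW: "h x \<in> carrier W" if "x \<in> carrier V" for x
      using h that by auto
    have h0: "h \<zero>\<^bsub>V\<^esub> = \<zero>\<^bsub>W\<^esub>"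
      using smult[rule_format, of "\<zero>\<^bsub>V\<^esub>" 0] hW[of "\<zero>\<^bsub>V\<^esub>"] by simp
    have diff: "h (x \<ominus>\<^bsub>V\<^esub> y) = h x \<ominus>\<^bsub>W\<^esub> h y" if "x \<in> carrier V" "y \<in> carrier V" for x y
      using that add smult hW by (simp add: V.diff_eq_smult W.diff_eq_smult)
    show ?thesis
      unfolding V.VM.metric_continuous_map[OF W.VM.Metric_space_axioms]
    proof (intro iffI conjI ballI allI impI)
      assume "h ` carrier V \<subseteq> carrier W \<and> (\<forall>a\<in>carrier V. \<forall>\<epsilon>>0. \<exists>\<delta>>0.
        \<forall>x. x \<in> carrier V \<and> vdist V a x < \<delta> \<longrightarrow> vdist W (h a) (h x) < \<epsilon>)"
      \<comment> \<open>Continuity at the origin with tolerance 1 is enough; homogeneity spreads the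
        bound over the whole space.\<close>
      then obtain d where "d > 0"
        and d: "\<And>x. x \<in> carrier V \<and> vdist V \<zero>\<^bsub>V\<^esub> x < d \<Longrightarrow> vdist W (h \<zero>\<^bsub>V\<^esub>) (h x) < 1"
        by (metis V.VS.M.zero_closed zero_less_one)
      have d: "vnorm W (h x) < 1" if "x \<in> carrier V" "vnorm V x < d" for x
        using d[of x] that hW h0 by (simp add: a_minus_def)
      have "vnorm W (h x) \<le> 2 / d * vnorm V x" if x: "x \<in> carrier V" for x
      proof (cases "x = \<zero>\<^bsub>V\<^esub>")
        case True
        then show ?thesis
          by (simp add: h0)
      next
        case False
        then have pos: "vnorm V x > 0"
          using x V.vnorm_nonneg[of x] V.vnorm_eq_zero_iff[of x] by linarith
        \<comment> \<open>The scalar brings x to norm \<open>d / 2\<close>, strictly inside the ball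
          of radius d.\<close>
        define c where "c = complex_of_real (d / 2 / vnorm V x)"
        have c: "cmod c = d / 2 / vnorm V x"
          using pos \<open>d > 0\<close> by (simp add: c_def norm_divide norm_mult)
        have "vnorm W (h (c \<odot>\<^bsub>V\<^esub> x)) < 1"
          using x pos \<open>d > 0\<close> by (intro d) (auto simp: V.vnorm_smult c)
        then have "d / 2 / vnorm V x * vnorm W (h x) < 1"
          using x smult hW by (simp add: W.vnorm_smult c)
        then show ?thesis
          using pos \<open>d > 0\<close> by (simp add: field_simps)
      qed
      then show "\<exists>K\<ge>0. \<forall>x\<in>carrier V. vnorm W (h x) \<le> K * vnorm V x"
        using \<open>d > 0\<close> by (intro exI[of _ "2 / d"]) auto
    next
      show "h ` carrier V \<subseteq> carrier W"
        using hW by auto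
    next
      fix a and e :: real
      assume "\<exists>K\<ge>0. \<forall>x\<in>carrier V. vnorm W (h x) \<le> K * vnorm V x" and a: "a \<in> carrier V" and "e > 0"
      then obtain K where "K \<ge> 0" and K: "\<And>x. x \<in> carrier V \<Longrightarrow> vnorm W (h x) \<le> K * vnorm V x"
        by blast
      \<comment> \<open>The radius is \<open>e / (K + 1)\<close> rather than \<open>e / K\<close>
        because K may be 0.\<close>
      have "vdist W (h a) (h x) < e" if "x \<in> carrier V" "vdist V a x < e / (K + 1)" for x
      proof -
        have "vdist W (h a) (h x) \<le> K * vdist V a x"
          using a that K[of "a \<ominus>\<^bsub>V\<^esub> x"] hW by (simp add: diff)
        also have "\<dots> \<le> (K + 1) * vdist V a x"
          by (intro mult_right_mono) auto
        also have "\<dots> < e"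
          using that \<open>K \<ge> 0\<close> by (simp add: field_simps del: V.vdist_eq)
        finally show ?thesis .
      qed
      then show "\<exists>d>0. \<forall>x. x \<in> carrier V \<and> vdist V a x < d \<longrightarrow> vdist W (h a) (h x) < e"
        using \<open>K \<ge> 0\<close> \<open>e > 0\<close> by (intro exI[of _ "e / (K + 1)"]) auto
    qed
  qed
  then show ?thesis
    by (auto simp: Hom_def continuous_linear_maps_def)
qed

lemma HomI:
  assumes "\<And>x. x \<notin> carrier V \<Longrightarrow> h x = undefined" and "\<And>x. x \<in> carrier V \<Longrightarrow> h x \<in> carrier W"
    and "\<And>x y. \<lbrakk>x \<in> carrier V; y \<in> carrier V\<rbrakk> \<Longrightarrow> h (x \<oplus>\<^bsub>V\<^esub> y) = h x \<oplus>\<^bsub>W\<^esub> h y"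
    and "\<And>c x. x \<in> carrier V \<Longrightarrow> h (c \<odot>\<^bsub>V\<^esub> x) = c \<odot>\<^bsub>W\<^esub> h x"
    and "\<And>x. x \<in> carrier V \<Longrightarrow> vnorm W (h x) \<le> K * vnorm V x" and "K \<ge> 0"
  shows "h \<in> carrier (Hom V W)"
  unfolding Hom_iff using assms by (auto simp: PiE_iff extensional_def)

section \<open>The operator norm\<close>

context
  fixes h assumes h: "h \<in> carrier (Hom V W)"
begin

lemma Hom_closed: "x \<in> carrier V \<Longrightarrow> h x \<in> carrier W"
  and Hom_undefined: "x \<notin> carrier V \<Longrightarrow> h x = undefined"
  and Hom_add: "\<lbrakk>x \<in> carrier V; y \<in> carrier V\<rbrakk> \<Longrightarrow> h (x \<oplus>\<^bsub>V\<^esub> y) = h x \<oplus>\<^bsub>W\<^esub> h y"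
  and Hom_smult: "x \<in> carrier V \<Longrightarrow> h (c \<odot>\<^bsub>V\<^esub> x) = c \<odot>\<^bsub>W\<^esub> h x"
  using h by (auto simp: Hom_iff)

lemma Hom_0: "h \<zero>\<^bsub>V\<^esub> = \<zero>\<^bsub>W\<^esub>"
  using Hom_smult[of "\<zero>\<^bsub>V\<^esub>" 0] Hom_closed[of "\<zero>\<^bsub>V\<^esub>"] by simp

text \<open>Boundedness gives the supremum in \<open>Hom\<close> its meaning: the real
  \<open>SUP\<close> of a set that is not bounded above carries no information.\<close>

lemma Hom_norm_upper:
  assumes "x \<in> carrier V" "vnorm V x \<le> 1"
  shows "vnorm W (h x) \<le> vnorm (Hom V W) h"
proof -
  obtain K where "K \<ge> 0" and K: "\<And>x. x \<in> carrier V \<Longrightarrow> vnorm W (h x) \<le> K * vnorm V x"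
    using h unfolding Hom_iff by blast
  have "vnorm W (h x) \<le> K" if "x \<in> carrier V" "vnorm V x \<le> 1" for x
    using K[of x] that mult_left_mono[of "vnorm V x" 1 K] \<open>K \<ge> 0\<close> by simp
  then have "bdd_above ((\<lambda>x. vnorm W (h x)) ` {x \<in> carrier V. vnorm V x \<le> 1})"
    by (intro bdd_aboveI[of _ K]) auto
  then show ?thesis
    unfolding Hom_def using assms by (auto intro!: cSUP_upper)
qed

lemma Hom_norm_nonneg: "vnorm (Hom V W) h \<ge> 0"
  using Hom_norm_upper[of "\<zero>\<^bsub>V\<^esub>"] by (simp add: Hom_0)

lemma Hom_bound:
  assumes x: "x \<in> carrier V"
  shows "vnorm W (h x) \<le> vnorm (Hom V W) h * vnorm V x"
proof (cases "x = \<zero>\<^bsub>V\<^esub>")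
  case True
  then show ?thesis
    by (simp add: Hom_0)
next
  case False
  then have pos: "vnorm V x > 0"
    using x V.vnorm_nonneg[of x] V.vnorm_eq_zero_iff[of x] by linarith
  define c where "c = complex_of_real (1 / vnorm V x)"
  have c: "cmod c = 1 / vnorm V x"
    using pos by (simp add: c_def norm_divide)
  have "vnorm W (h (c \<odot>\<^bsub>V\<^esub> x)) \<le> vnorm (Hom V W) h"
    using x pos by (intro Hom_norm_upper) (auto simp: V.vnorm_smult c)
  then show ?thesis
    using x pos Hom_closed[of x] by (simp add: Hom_smult W.vnorm_smult c field_simps)
qed

end

text \<open>A single estimate with a constant K serves twice for a new map: here for its operator
  norm and in \<open>HomI\<close> for its continuity.\<close>

lemma Hom_norm_le:
  assumes "\<And>x. x \<in> carrier V \<Longrightarrow> vnorm W (h x) \<le> K * vnorm V x" and "K \<ge> 0"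
  shows "vnorm (Hom V W) h \<le> K"
proof -
  have "vnorm W (h x) \<le> K" if "x \<in> carrier V" "vnorm V x \<le> 1" for x
    using assms(1)[of x] that mult_left_mono[of "vnorm V x" 1 K] \<open>K \<ge> 0\<close> by simp
  then show ?thesis
    unfolding Hom_def by (auto intro!: cSUP_least exI[of _ "\<zero>\<^bsub>V\<^esub>"])
qed

lemma Hom_eqI:
  assumes "g \<in> carrier (Hom V W)" "h \<in> carrier (Hom V W)" "\<And>x. x \<in> carrier V \<Longrightarrow> g x = h x"
  shows "g = h"
  using assms Hom_undefined by (metis ext)

section \<open>The normed space of continuous linear maps\<close>

lemma zero_in_Hom: "\<zero>\<^bsub>Hom V W\<^esub> \<in> carrier (Hom V W)"
  by (rule HomI[where K = 0]) auto

lemma add_in_Hom: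
  assumes g: "g \<in> carrier (Hom V W)" and h: "h \<in> carrier (Hom V W)"
  shows "g \<oplus>\<^bsub>Hom V W\<^esub> h \<in> carrier (Hom V W)"
    and "vnorm (Hom V W) (g \<oplus>\<^bsub>Hom V W\<^esub> h) \<le> vnorm (Hom V W) g + vnorm (Hom V W) h"
proof -
  note gh = Hom_closed[OF g] Hom_closed[OF h]
  let ?K = "vnorm (Hom V W) g + vnorm (Hom V W) h"
  have K: "vnorm W ((g \<oplus>\<^bsub>Hom V W\<^esub> h) x) \<le> ?K * vnorm V x" if "x \<in> carrier V" for x
    using W.vnorm_triangle[of "g x" "h x"] gh[OF that] Hom_bound[OF g that] Hom_bound[OF h that] that
    by (simp add: distrib_right)
  have "?K \<ge> 0"
    using Hom_norm_nonneg[OF g] Hom_norm_nonneg[OF h] by simp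
  with K show "vnorm (Hom V W) (g \<oplus>\<^bsub>Hom V W\<^esub> h) \<le> ?K"
    by (intro Hom_norm_le)
  show "g \<oplus>\<^bsub>Hom V W\<^esub> h \<in> carrier (Hom V W)"
    by (rule HomI[OF _ _ _ _ K \<open>?K \<ge> 0\<close>])
      (auto simp: gh Hom_add[OF g] Hom_add[OF h] Hom_smult[OF g] Hom_smult[OF h]
        W.smult_add_right W.VS.M.a_ac)
qed

lemma smult_in_Hom:
  assumes h: "h \<in> carrier (Hom V W)"
  shows "c \<odot>\<^bsub>Hom V W\<^esub> h \<in> carrier (Hom V W)"
    and "vnorm (Hom V W) (c \<odot>\<^bsub>Hom V W\<^esub> h) \<le> cmod c * vnorm (Hom V W) h"
proof -
  let ?K = "cmod c * vnorm (Hom V W) h"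
  have K: "vnorm W ((c \<odot>\<^bsub>Hom V W\<^esub> h) x) \<le> ?K * vnorm V x" if "x \<in> carrier V" for x
    using Hom_closed[OF h] Hom_bound[OF h] that
    by (simp add: W.vnorm_smult mult.assoc mult_left_mono)
  have "?K \<ge> 0"
    using Hom_norm_nonneg[OF h] by simp
  with K show "vnorm (Hom V W) (c \<odot>\<^bsub>Hom V W\<^esub> h) \<le> ?K"
    by (intro Hom_norm_le)
  show "c \<odot>\<^bsub>Hom V W\<^esub> h \<in> carrier (Hom V W)"
    by (rule HomI[OF _ _ _ _ K \<open>?K \<ge> 0\<close>])
      (auto simp: Hom_closed[OF h] Hom_add[OF h] Hom_smult[OF h] W.smult_add_right
        W.smult_smult mult.commute)
qed

lemma module_Hom: "Module.module complex_field (Hom V W)"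
proof (rule moduleI)
  show "cring complex_field"
    by (rule V.VS.R.cring_axioms)
  show "abelian_group (Hom V W)"
  proof (rule abelian_groupI)
    fix g h k
    assume [simp]: "g \<in> carrier (Hom V W)" "h \<in> carrier (Hom V W)" "k \<in> carrier (Hom V W)"
    note [simp] = Hom_closed[of g] Hom_closed[of h] Hom_closed[of k]
    show "g \<oplus>\<^bsub>Hom V W\<^esub> h \<in> carrier (Hom V W)"
      by (simp add: add_in_Hom del: Hom_simps)
    show "(g \<oplus>\<^bsub>Hom V W\<^esub> h) \<oplus>\<^bsub>Hom V W\<^esub> k = g \<oplus>\<^bsub>Hom V W\<^esub> (h \<oplus>\<^bsub>Hom V W\<^esub> k)"
      by (auto simp: W.VS.M.a_ac)
    show "g \<oplus>\<^bsub>Hom V W\<^esub> h = h \<oplus>\<^bsub>Hom V W\<^esub> g"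
      by (auto simp: W.VS.M.a_ac)
    show "\<zero>\<^bsub>Hom V W\<^esub> \<oplus>\<^bsub>Hom V W\<^esub> g = g"
      by (auto simp: restrict_def Hom_undefined[of g])
    have "((-1) \<odot>\<^bsub>Hom V W\<^esub> g) \<oplus>\<^bsub>Hom V W\<^esub> g = \<zero>\<^bsub>Hom V W\<^esub>"
      by (auto simp: W.minus_eq_smult[symmetric] W.VS.M.l_neg)
    then show "\<exists>h\<in>carrier (Hom V W). h \<oplus>\<^bsub>Hom V W\<^esub> g = \<zero>\<^bsub>Hom V W\<^esub>"
      using smult_in_Hom(1)[OF \<open>g \<in> carrier (Hom V W)\<close>, of "-1"] by blast
  qed (rule zero_in_Hom)
  fix c d g h
  assume g: "g \<in> carrier (Hom V W)" and h: "h \<in> carrier (Hom V W)"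
  note [simp] = Hom_closed[OF g] Hom_closed[OF h]
  show "c \<odot>\<^bsub>Hom V W\<^esub> g \<in> carrier (Hom V W)"
    using g by (rule smult_in_Hom)
  show "(c \<oplus>\<^bsub>complex_field\<^esub> d) \<odot>\<^bsub>Hom V W\<^esub> g = c \<odot>\<^bsub>Hom V W\<^esub> g \<oplus>\<^bsub>Hom V W\<^esub> d \<odot>\<^bsub>Hom V W\<^esub> g"
    by (auto simp: complex_field_def W.smult_add_left)
  show "c \<odot>\<^bsub>Hom V W\<^esub> (g \<oplus>\<^bsub>Hom V W\<^esub> h) = c \<odot>\<^bsub>Hom V W\<^esub> g \<oplus>\<^bsub>Hom V W\<^esub> c \<odot>\<^bsub>Hom V W\<^esub> h"
    by (auto simp: W.smult_add_right)
  show "(c \<otimes>\<^bsub>complex_field\<^esub> d) \<odot>\<^bsub>Hom V W\<^esub> g = c \<odot>\<^bsub>Hom V W\<^esub> (d \<odot>\<^bsub>Hom V W\<^esub> g)"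
    by (auto simp: complex_field_def W.smult_smult)
  show "\<one>\<^bsub>complex_field\<^esub> \<odot>\<^bsub>Hom V W\<^esub> g = g"
    using Hom_undefined[OF g] by (auto simp: complex_field_def)
qed

lemma complex_normed_space_Hom: "complex_normed_space (Hom V W)"
proof (intro complex_normed_space.intro module_Hom)
  show "vnorm (Hom V W) h = 0 \<longleftrightarrow> h = \<zero>\<^bsub>Hom V W\<^esub>" if h: "h \<in> carrier (Hom V W)" for h
  proof
    assume "vnorm (Hom V W) h = 0"
    then have "h x = \<zero>\<^bsub>W\<^esub>" if "x \<in> carrier V" for x
      using Hom_bound[OF h that] Hom_closed[OF h that] W.vnorm_nonneg[of "h x"]
      by (simp add: W.vnorm_eq_zero_iff)
    then show "h = \<zero>\<^bsub>Hom V W\<^esub>"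
      by (intro Hom_eqI[OF h zero_in_Hom]) auto
  next
    assume "h = \<zero>\<^bsub>Hom V W\<^esub>"
    then have "vnorm (Hom V W) h \<le> 0"
      by (intro Hom_norm_le) auto
    then show "vnorm (Hom V W) h = 0"
      using Hom_norm_nonneg[OF h] by simp
  qed
  show "vnorm (Hom V W) (g \<oplus>\<^bsub>Hom V W\<^esub> h) \<le> vnorm (Hom V W) g + vnorm (Hom V W) h"
    if "g \<in> carrier (Hom V W)" "h \<in> carrier (Hom V W)" for g h
    using that by (rule add_in_Hom)
  show "vnorm (Hom V W) (c \<odot>\<^bsub>Hom V W\<^esub> h) = cmod c * vnorm (Hom V W) h"
    if h: "h \<in> carrier (Hom V W)" for c h
  proof (cases "c = 0")
    case True
    with smult_in_Hom[OF h, of c] Hom_norm_nonneg[of "c \<odot>\<^bsub>Hom V W\<^esub> h"] show ?thesis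
      by simp
  next
    case False
    note ch = smult_in_Hom(1)[OF h, of c]
    \<comment> \<open>The reverse inequality is the one already known, applied to the scalar
      \<open>1 / c\<close> and the map c h.\<close>
    have "(1 / c) \<odot>\<^bsub>Hom V W\<^esub> (c \<odot>\<^bsub>Hom V W\<^esub> h) = h"
      using False Hom_undefined[OF h] Hom_closed[OF h] by (auto simp: W.smult_smult)
    then have "vnorm (Hom V W) h \<le> cmod (1 / c) * vnorm (Hom V W) (c \<odot>\<^bsub>Hom V W\<^esub> h)"
      using smult_in_Hom(2)[OF ch, of "1 / c"] by metis
    then show ?thesis
      using smult_in_Hom(2)[OF h, of c] False by (simp add: norm_divide field_simps)
  qed
qed

lemma Hom_diff_apply:
  assumes "g \<in> carrier (Hom V W)" "h \<in> carrier (Hom V W)" "x \<in> carrier V"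
  shows "(g \<ominus>\<^bsub>Hom V W\<^esub> h) x = g x \<ominus>\<^bsub>W\<^esub> h x"
  using assms Hom_closed
  by (simp add: complex_normed_space.diff_eq_smult[OF complex_normed_space_Hom] W.diff_eq_smult)

end

text \<open>Completeness of the target yields a pointwise limit. The Cauchy estimate is uniform on
  bounded sets, which makes the limit continuous and the convergence one in operator norm.\<close>

lemma complex_banach_space_Hom:
  assumes "complex_normed_space V" and "complex_banach_space W"
  shows "complex_banach_space (Hom V W)"
proof -
  interpret V: complex_normed_space V by fact
  interpret W: complex_banach_space W by fact
  interpret complex_normed_space_pair V W ..
  interpret H: complex_normed_space "Hom V W"
    by (rule complex_normed_space_Hom)
  show ?thesis
  proof (intro complex_banach_space.intro complex_banach_space_axioms.intro complex_normed_space_Hom)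
    show "H.VM.mcomplete"
      unfolding H.VM.mcomplete_def
    proof (intro allI impI)
      fix X assume "H.VM.MCauchy X"
      then have "range X \<subseteq> carrier (Hom V W)"
        and Cauchy: "\<forall>e>0. \<exists>N. \<forall>n m. N \<le> n \<longrightarrow> N \<le> m \<longrightarrow> vdist (Hom V W) (X n) (X m) < e"
        unfolding H.VM.MCauchy_def by (rule conjunct1, rule conjunct2)
      then have X: "X n \<in> carrier (Hom V W)" for n
        by auto
      \<comment> \<open>The index N is chosen before x: this uniformity is what survives in the
        limit.\<close>
      have Cauchy: "\<exists>N. \<forall>n\<ge>N. \<forall>m\<ge>N. \<forall>x\<in>carrier V. vnorm W (X n x \<ominus>\<^bsub>W\<^esub> X m x) \<le> e * vnorm V x"
        if "e > 0" for e
      proof -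
        obtain N where N: "vnorm (Hom V W) (X n \<ominus>\<^bsub>Hom V W\<^esub> X m) < e" if "n \<ge> N" "m \<ge> N" for n m
          using Cauchy[rule_format, OF \<open>e > 0\<close>] X by auto
        have "vnorm W (X n x \<ominus>\<^bsub>W\<^esub> X m x) \<le> e * vnorm V x"
          if "n \<ge> N" "m \<ge> N" and x: "x \<in> carrier V" for n m x
        proof -
          have "vnorm W (X n x \<ominus>\<^bsub>W\<^esub> X m x) \<le> vnorm (Hom V W) (X n \<ominus>\<^bsub>Hom V W\<^esub> X m) * vnorm V x"
            using Hom_bound[of "X n \<ominus>\<^bsub>Hom V W\<^esub> X m" x] X x by (simp add: Hom_diff_apply)
          also have "\<dots> \<le> e * vnorm V x"
            using N[OF that(1,2)] V.vnorm_nonneg[OF x] by (intro mult_right_mono) auto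
          finally show ?thesis .
        qed
        then show ?thesis
          by blast
      qed
      have "\<exists>y. limitin (vtopology W) (\<lambda>n. X n x) y sequentially" if x: "x \<in> carrier V" for x
      proof -
        have "W.VM.MCauchy (\<lambda>n. X n x)"
          unfolding W.VM.MCauchy_def
        proof (intro conjI allI impI)
          show "range (\<lambda>n. X n x) \<subseteq> carrier W"
            using Hom_closed[OF X x] by auto
          fix e :: real assume "e > 0"
          \<comment> \<open>Adding 1 allows the division also for x = 0.\<close>
          have pos: "vnorm V x + 1 > 0"
            using V.vnorm_nonneg[OF x] by simp
          obtain N where N: "\<forall>n\<ge>N. \<forall>m\<ge>N. \<forall>y\<in>carrier V.
              vnorm W (X n y \<ominus>\<^bsub>W\<^esub> X m y) \<le> e / (vnorm V x + 1) * vnorm V y"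
            using Cauchy[of "e / (vnorm V x + 1)"] pos \<open>e > 0\<close> by auto
          have "e / (vnorm V x + 1) * vnorm V x < e"
            using pos \<open>e > 0\<close> by (simp add: field_simps)
          then have "vdist W (X n x) (X m x) < e" if "n \<ge> N" "m \<ge> N" for n m
            using N that x Hom_closed[OF X x] by fastforce
          then show "\<exists>N. \<forall>n m. N \<le> n \<longrightarrow> N \<le> m \<longrightarrow> vdist W (X n x) (X m x) < e"
            by blast
        qed
        then show ?thesis
          using W.complete by (auto simp: W.VM.mcomplete_def)
      qed
      then obtain l where l: "\<And>x. x \<in> carrier V \<Longrightarrow> limitin (vtopology W) (\<lambda>n. X n x) (l x) sequentially"
        by metis
      then have lW: "l x \<in> carrier W" if "x \<in> carrier V" for x
        using that by (auto simp: W.VM.limitin_metric)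
      have XW: "range (\<lambda>n. X n x) \<subseteq> carrier W" if "x \<in> carrier V" for x
        using Hom_closed[OF X that] by auto
      \<comment> \<open>The index m of the Cauchy estimate tends to infinity while n and x are
        fixed, so N still does not depend on x.\<close>
      have conv: "\<exists>N. \<forall>n\<ge>N. \<forall>x\<in>carrier V. vnorm W (X n x \<ominus>\<^bsub>W\<^esub> l x) \<le> e * vnorm V x"
        if "e > 0" for e
      proof -
        obtain N where N: "\<forall>n\<ge>N. \<forall>m\<ge>N. \<forall>x\<in>carrier V.
            vnorm W (X n x \<ominus>\<^bsub>W\<^esub> X m x) \<le> e * vnorm V x"
          using Cauchy[OF \<open>e > 0\<close>] by blast
        have "vnorm W (X n x \<ominus>\<^bsub>W\<^esub> l x) \<le> e * vnorm V x" if "n \<ge> N" "x \<in> carrier V" for n x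
          using that N by (intro W.vnorm_limit_le[OF l XW, where N = N]) (auto intro: Hom_closed[OF X])
        then show ?thesis
          by blast
      qed
      define h where "h = (\<lambda>x\<in>carrier V. l x)"
      have h_l: "h x = l x" if "x \<in> carrier V" for x
        using that by (simp add: h_def)
      \<comment> \<open>Tolerance 1 is arbitrary: one member of the sequence at bounded distance
        from the limit gives the constant \<open>vnorm (Hom V W) (X N) + 1\<close> for the
        limit.\<close>
      obtain N where N: "\<forall>n\<ge>N. \<forall>x\<in>carrier V. vnorm W (X n x \<ominus>\<^bsub>W\<^esub> l x) \<le> 1 * vnorm V x"
        using conv[of 1] by auto
      have h: "h \<in> carrier (Hom V W)"
      proof (rule HomI[where K = "vnorm (Hom V W) (X N) + 1"])
        fix x y assume xy: "x \<in> carrier V" "y \<in> carrier V"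
        have "limitin (vtopology W) (\<lambda>n. X n (x \<oplus>\<^bsub>V\<^esub> y)) (l x \<oplus>\<^bsub>W\<^esub> l y) sequentially"
          using W.limitin_add[OF l l XW XW] xy by (simp add: Hom_add[OF X])
        then have "l (x \<oplus>\<^bsub>V\<^esub> y) = l x \<oplus>\<^bsub>W\<^esub> l y"
          using xy l[of "x \<oplus>\<^bsub>V\<^esub> y"] W.VM.limitin_metric_unique trivial_limit_sequentially by blast
        then show "h (x \<oplus>\<^bsub>V\<^esub> y) = h x \<oplus>\<^bsub>W\<^esub> h y"
          using xy by (simp add: h_def)
      next
        fix c x assume x: "x \<in> carrier V"
        have "limitin (vtopology W) (\<lambda>n. X n (c \<odot>\<^bsub>V\<^esub> x)) (c \<odot>\<^bsub>W\<^esub> l x) sequentially"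
          using W.limitin_smult[OF l XW] x by (simp add: Hom_smult[OF X])
        then have "l (c \<odot>\<^bsub>V\<^esub> x) = c \<odot>\<^bsub>W\<^esub> l x"
          using x l[of "c \<odot>\<^bsub>V\<^esub> x"] W.VM.limitin_metric_unique trivial_limit_sequentially by blast
        then show "h (c \<odot>\<^bsub>V\<^esub> x) = c \<odot>\<^bsub>W\<^esub> h x"
          using x by (simp add: h_def)
      next
        fix x assume x: "x \<in> carrier V"
        note W = lW[OF x] Hom_closed[OF X[of N] x]
        have "vnorm W (l x) \<le> vnorm W (X N x) + vnorm W (X N x \<ominus>\<^bsub>W\<^esub> l x)"
          using W.vnorm_diff_triangle[of "l x" "X N x" "\<zero>\<^bsub>W\<^esub>"] W W.vnorm_diff_commute[of "l x" "X N x"]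
          by (simp add: W.diff_eq_smult)
        also have "\<dots> \<le> vnorm (Hom V W) (X N) * vnorm V x + 1 * vnorm V x"
          using Hom_bound[OF X x] N x by (intro add_mono) auto
        finally show "vnorm W (h x) \<le> (vnorm (Hom V W) (X N) + 1) * vnorm V x"
          using x by (simp add: h_def distrib_right)
      next
        show "0 \<le> vnorm (Hom V W) (X N) + 1"
          using Hom_norm_nonneg[OF X[of N]] by simp
      qed (auto simp: h_def lW)
      have "limitin (vtopology (Hom V W)) X h sequentially"
        unfolding H.VM.limit_metric_sequentially
      proof (intro conjI allI impI h)
        fix e :: real assume "e > 0"
        obtain N where N: "\<forall>n\<ge>N. \<forall>x\<in>carrier V. vnorm W (X n x \<ominus>\<^bsub>W\<^esub> l x) \<le> e / 2 * vnorm V x"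
          using conv[of "e / 2"] \<open>e > 0\<close> by auto
        have "vnorm (Hom V W) (X n \<ominus>\<^bsub>Hom V W\<^esub> h) \<le> e / 2" if "n \<ge> N" for n
          using N that \<open>e > 0\<close> by (intro Hom_norm_le) (auto simp: Hom_diff_apply[OF X h] h_l)
        then have "vdist (Hom V W) (X n) h < e" if "n \<ge> N" for n
          using that X h \<open>e > 0\<close> by fastforce
        then show "\<exists>N. \<forall>n\<ge>N. X n \<in> carrier (Hom V W) \<and> vdist (Hom V W) (X n) h < e"
          using X by blast
      qed
      then show "\<exists>h. limitin (vtopology (Hom V W)) X h sequentially"
        by blast
    qed
  qed
qed

lemma compose_in_Hom:
  assumes "complex_normed_space U" "complex_normed_space V" "complex_normed_space W"
    and g: "g \<in> carrier (Hom V W)" and h: "h \<in> carrier (Hom U V)"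
  shows "compose (carrier U) g h \<in> carrier (Hom U W)"
    and "vnorm (Hom U W) (compose (carrier U) g h) \<le> vnorm (Hom V W) g * vnorm (Hom U V) h"
proof -
  interpret UV: complex_normed_space_pair U V
    using assms by (simp add: complex_normed_space_pair_def)
  interpret VW: complex_normed_space_pair V W
    using assms by (simp add: complex_normed_space_pair_def)
  interpret UW: complex_normed_space_pair U W
    using assms by (simp add: complex_normed_space_pair_def)
  let ?K = "vnorm (Hom V W) g * vnorm (Hom U V) h"
  note closed = UV.Hom_closed[OF h] VW.Hom_closed[OF g]
  have K: "vnorm W (compose (carrier U) g h x) \<le> ?K * vnorm U x" if x: "x \<in> carrier U" for x
  proof -
    have "vnorm W (g (h x)) \<le> vnorm (Hom V W) g * vnorm V (h x)"
      using x closed by (intro VW.Hom_bound[OF g])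
    also have "\<dots> \<le> vnorm (Hom V W) g * (vnorm (Hom U V) h * vnorm U x)"
      using x by (intro mult_left_mono UV.Hom_bound[OF h] VW.Hom_norm_nonneg[OF g])
    finally show ?thesis
      using x by (simp add: compose_def mult.assoc)
  qed
  have "?K \<ge> 0"
    using UV.Hom_norm_nonneg[OF h] VW.Hom_norm_nonneg[OF g] by simp
  with K show "vnorm (Hom U W) (compose (carrier U) g h) \<le> ?K"
    by (intro UW.Hom_norm_le)
  show "compose (carrier U) g h \<in> carrier (Hom U W)"
    by (rule UW.HomI[OF _ _ _ _ K \<open>?K \<ge> 0\<close>])
      (auto simp: compose_def closed UV.Hom_add[OF h] UV.Hom_smult[OF h]
        VW.Hom_add[OF g] VW.Hom_smult[OF g])
qed

section \<open>Powers of horizontal sections\<close>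

text \<open>The quotient \<open>n^n / n!\<close> is a single term of the series for
  \<open>e^n\<close>, all of whose terms are nonnegative.\<close>

lemma power_self_le_exp_fact: "real n ^ n \<le> exp 1 ^ n * fact n"
proof -
  have "(real n ^ n) / fact n = (\<Sum>k\<in>{n}. real n ^ k /\<^sub>R fact k)"
    by (simp add: divide_inverse mult.commute)
  also have "\<dots> \<le> exp (real n)"
    unfolding exp_def by (intro sum_le_suminf summable_exp_generic) auto
  also have "\<dots> = exp 1 ^ n"
    by (simp flip: exp_of_nat_mult)
  finally show ?thesis
    by (simp add: field_simps)
qed

lemma weight_power_pos:
  assumes "weight_function B \<mu>" "p \<in> Delta B" "n \<ge> 1"
  shows "weight_power \<mu> n p > 0"
  using assms by (auto simp: weight_power_def weight_function_def)

lemma Delta_at_iff: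
  "(t', s') \<in> Delta_at B (t, s) \<longleftrightarrow> t' \<in> B \<and> s' \<in> B \<and> t' > s' \<and> t' \<le> t \<and> s' \<ge> s"
  by (auto simp: Delta_at_def Delta_def)

section \<open>Composition of horizontal sections\<close>

context kolmogorov_space
begin

lemma normed_fibre: "b \<in> B \<Longrightarrow> complex_normed_space (E b)"
  using banach complex_banach_space.axioms(1) by blast

lemma normed_fibre_pair: "\<lbrakk>a \<in> B; b \<in> B\<rbrakk> \<Longrightarrow> complex_normed_space_pair (E a) (E b)"
  by (simp add: complex_normed_space_pair_def normed_fibre)

lemma connecting_refl_apply: "\<lbrakk>a \<in> B; x \<in> carrier (E a)\<rbrakk> \<Longrightarrow> \<iota> a a x = x"
  by (simp add: connecting_refl)

lemma connecting_closed:
  "\<lbrakk>a \<in> B; b \<in> B; b \<le> a; x \<in> carrier (E a)\<rbrakk> \<Longrightarrow> \<iota> b a x \<in> carrier (E b)"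
  using complex_normed_space_pair.Hom_closed[OF normed_fibre_pair connecting] by blast

lemma section_in_Hom:
  "\<lbrakk>u \<in> horizontal_sections E \<iota> A; (t, s) \<in> A\<rbrakk> \<Longrightarrow> u (t, s) \<in> carrier (Hom (E t) (E s))"
  unfolding horizontal_sections_def by fastforce

lemma section_closed:
  assumes "u \<in> horizontal_sections E \<iota> (Delta_at B (t, s))" "(t', s') \<in> Delta_at B (t, s)"
    and "x \<in> carrier (E t')"
  shows "u (t', s') x \<in> carrier (E s')"
  using complex_normed_space_pair.Hom_closed[OF normed_fibre_pair section_in_Hom[OF assms(1,2)]]
    assms(2,3) by (simp add: Delta_at_iff)

lemma section_apply:
  assumes "u \<in> horizontal_sections E \<iota> A" "(t', s') \<in> A" "(t'', s'') \<in> A" "t'' \<ge> t'" "s' \<ge> s''"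
    and "x \<in> carrier (E t'')"
  shows "u (t'', s'') x = \<iota> s'' s' (u (t', s') (\<iota> t' t'' x))"
proof -
  have "u (t'', s'') =
      compose (carrier (E t'')) (\<iota> s'' s') (compose (carrier (E t'')) (u (t', s')) (\<iota> t' t''))"
    using assms(1-5) unfolding horizontal_sections_def by blast
  then show ?thesis
    using assms(6) by (simp add: compose_def)
qed

text \<open>Independence of the intermediate point: for b \<le> a, horizontality of v absorbs the
  connecting map from a to b on one side and horizontality of u on the other, so the composites
  through a and through b are both v(b, s') after \<iota> b a after u(t', a). This leaves every
  later estimate free to choose its own r.\<close>

lemma section_comp_eq:
  assumes v: "v \<in> horizontal_sections E \<iota> (Delta_at B (t, s))"
    and u: "u \<in> horizontal_sections E \<iota> (Delta_at B (t, s))"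
    and A: "(t', s') \<in> Delta_at B (t, s)" and r: "r \<in> B" "s' < r" "r < t'"
  shows "section_comp B E (t, s) v u (t', s') = compose (carrier (E t')) (v (r, s')) (u (t', r))"
proof -
  have *: "compose (carrier (E t')) (v (a, s')) (u (t', a)) = compose (carrier (E t')) (v (b, s')) (u (t', b))"
    if a: "a \<in> B" "a < t'" and b: "b \<in> B" "s' < b" and "b \<le> a" for a b
  proof -
    have AB: "(a, s') \<in> Delta_at B (t, s)" "(b, s') \<in> Delta_at B (t, s)"
      "(t', a) \<in> Delta_at B (t, s)" "(t', b) \<in> Delta_at B (t, s)" "t' \<in> B" "s' \<in> B"
      using that A by (auto simp: Delta_at_iff)
    have "v (a, s') (u (t', a) x) = v (b, s') (u (t', b) x)" if x: "x \<in> carrier (E t')" for x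
    proof -
      define y where "y = u (t', a) x"
      have y: "y \<in> carrier (E a)"
        unfolding y_def using section_closed[OF u AB(3) x] .
      have z: "\<iota> b a y \<in> carrier (E b)"
        using connecting_closed a b \<open>b \<le> a\<close> y by blast
      have "v (a, s') y = v (b, s') (\<iota> b a y)"
        using section_apply[OF v AB(2,1) \<open>b \<le> a\<close> order_refl y]
          connecting_refl_apply[OF \<open>s' \<in> B\<close> section_closed[OF v AB(2) z]] by simp
      moreover have "u (t', b) x = \<iota> b a y"
        using section_apply[OF u AB(3,4) order_refl \<open>b \<le> a\<close> x] connecting_refl_apply[OF \<open>t' \<in> B\<close> x]
        by (simp add: y_def)
      ultimately show ?thesis
        by (simp add: y_def)
    qed
    then show ?thesis
      by (auto simp: compose_def)
  qed
  \<comment> \<open>The given r settles uniqueness as well: with no admissible point the description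
    would be satisfied by every w.\<close>
  have "(THE w. \<forall>r\<in>B. t' > r \<and> r > s' \<longrightarrow> w = compose (carrier (E t')) (v (r, s')) (u (t', r)))
      = compose (carrier (E t')) (v (r, s')) (u (t', r))"
  proof (rule the_equality)
    show "\<forall>q\<in>B. t' > q \<and> q > s' \<longrightarrow> compose (carrier (E t')) (v (r, s')) (u (t', r))
        = compose (carrier (E t')) (v (q, s')) (u (t', q))"
      using *[of r] *[of _ r] r by (metis linorder_le_cases)
  qed (use r in blast)
  then show ?thesis
    using A by (simp add: section_comp_def)
qed

text \<open>Density provides a point r between s' and t'. It also lies between s'' and t'', so both
  composites factor through the same r; the connecting map at the source is then supplied by u and
  the one at the target by v.\<close>

lemma section_comp_horizontal:
  assumes dense: "densely_ordered B"
    and v: "v \<in> horizontal_sections E \<iota> (Delta_at B (t, s))"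
    and u: "u \<in> horizontal_sections E \<iota> (Delta_at B (t, s))"
  shows "section_comp B E (t, s) v u \<in> horizontal_sections E \<iota> (Delta_at B (t, s))"
proof -
  let ?w = "section_comp B E (t, s) v u"
  have between: "\<exists>r. r \<in> B \<and> s' < r \<and> r < t'" if "(t', s') \<in> Delta_at B (t, s)" for t' s'
    using dense that unfolding densely_ordered_def Delta_at_iff by blast
  have Hom: "?w (t', s') \<in> carrier (Hom (E t') (E s'))" if A: "(t', s') \<in> Delta_at B (t, s)" for t' s'
  proof -
    obtain r where r: "r \<in> B" "s' < r" "r < t'"
      using between[OF A] by blast
    have "v (r, s') \<in> carrier (Hom (E r) (E s'))" "u (t', r) \<in> carrier (Hom (E t') (E r))"
      using A r by (auto intro!: section_in_Hom[OF v] section_in_Hom[OF u] simp: Delta_at_iff)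
    then show ?thesis
      unfolding section_comp_eq[OF v u A r] using A r
      by (intro compose_in_Hom(1)[where V = "E r"]) (auto simp: Delta_at_iff normed_fibre)
  qed
  have horizontal: "?w (t'', s'') =
      compose (carrier (E t'')) (\<iota> s'' s') (compose (carrier (E t'')) (?w (t', s')) (\<iota> t' t''))"
    if A: "(t', s') \<in> Delta_at B (t, s)" and A': "(t'', s'') \<in> Delta_at B (t, s)"
      and le: "t' \<le> t''" "s'' \<le> s'" for t' s' t'' s''
  proof -
    obtain r where r: "r \<in> B" "s' < r" "r < t'"
      using between[OF A] by blast
    have r': "s'' < r" "r < t''"
      using r le by auto
    have AB: "(r, s') \<in> Delta_at B (t, s)" "(r, s'') \<in> Delta_at B (t, s)"
      "(t', r) \<in> Delta_at B (t, s)" "(t'', r) \<in> Delta_at B (t, s)" "t' \<in> B" "t'' \<in> B"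
      using r r' A A' by (auto simp: Delta_at_iff)
    have "v (r, s'') (u (t'', r) x) = \<iota> s'' s' (v (r, s') (u (t', r) (\<iota> t' t'' x)))"
      if x: "x \<in> carrier (E t'')" for x
    proof -
      define y where "y = u (t', r) (\<iota> t' t'' x)"
      have "y \<in> carrier (E r)"
        unfolding y_def using section_closed[OF u AB(3)] connecting_closed[of t'' t' x] AB le x by blast
      moreover have "u (t'', r) x = y"
        using section_apply[OF u AB(3,4) le(1) order_refl x]
          connecting_refl_apply[OF \<open>r \<in> B\<close> \<open>y \<in> carrier (E r)\<close>] by (simp add: y_def)
      ultimately show ?thesis
        using section_apply[OF v AB(1,2) order_refl le(2), of y] connecting_refl_apply[of r y] r
        by (simp add: y_def)
    qed
    then show ?thesis
      unfolding section_comp_eq[OF v u A r] section_comp_eq[OF v u A' r(1) r']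
      using connecting_closed[of t'' t'] AB le by (auto simp: compose_def)
  qed
  have "?w \<in> (\<Pi>\<^sub>E (t', s')\<in>Delta_at B (t, s). carrier (Hom (E t') (E s')))"
  proof (rule PiE_I)
    fix p assume "p \<in> Delta_at B (t, s)"
    then show "?w p \<in> (case p of (t', s') \<Rightarrow> carrier (Hom (E t') (E s')))"
      using Hom by (cases p) simp
  qed (simp add: section_comp_def)
  then show ?thesis
    unfolding horizontal_sections_def using horizontal by blast
qed

lemma section_power_horizontal:
  assumes "densely_ordered B" "v \<in> horizontal_sections E \<iota> (Delta_at B (t, s))"
  shows "section_power B E \<iota> (t, s) v (Suc n) \<in> horizontal_sections E \<iota> (Delta_at B (t, s))"
  using assms by (induction n) (auto intro: section_comp_horizontal)

section \<open>Norm estimates for powers\<close>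

lemma Lspace_bound:
  assumes "v \<in> carrier (Lspace B E \<iota> \<mu> p)" "(t', s') \<in> Delta_at B p"
  shows "\<mu> (t', s') * vnorm (Hom (E t') (E s')) (v (t', s')) \<le> vnorm (Lspace B E \<iota> \<mu> p) v"
  using cSUP_upper[OF assms(2), of "\<lambda>(t', s'). \<mu> (t', s') * vnorm (Hom (E t') (E s')) (v (t', s'))"]
    assms(1) by (simp add: Lspace_def)

text \<open>The induction runs over all pairs below (t, s) at once, since the step at (t', s') calls
  the hypothesis at (t', m) with an m not known in advance. It starts at exponent 1, where the claim
  is the definition of the norm and from which submultiplicativity applies.\<close>

lemma section_power_bound:
  assumes dense: "densely_ordered B" and weight: "weight_function B \<mu>"
    and sub: "submultiplicative B \<mu>"
    and v: "v \<in> carrier (Lspace B E \<iota> (weight_power \<mu> 1) (t, s))"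
    and "(t', s') \<in> Delta_at B (t, s)"
  shows "weight_power \<mu> (Suc n) (t', s') *
      vnorm (Hom (E t') (E s')) (section_power B E \<iota> (t, s) v (Suc n) (t', s'))
    \<le> vnorm (Lspace B E \<iota> (weight_power \<mu> 1) (t, s)) v ^ Suc n"
  using assms(5)
proof (induction n arbitrary: t' s')
  case 0
  then show ?case
    using Lspace_bound[OF v] by simp
next
  case (Suc n)
  define N where "N = vnorm (Lspace B E \<iota> (weight_power \<mu> 1) (t, s)) v"
  let ?w = "section_power B E \<iota> (t, s) v (Suc n)"
  have vh: "v \<in> horizontal_sections E \<iota> (Delta_at B (t, s))"
    using v by (simp add: Lspace_def)
  note wh = section_power_horizontal[OF dense vh, of n]
  have D: "(t', s') \<in> Delta B"
    using Suc.prems by (auto simp: Delta_at_iff Delta_def)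
  have "1 \<le> Suc n" "1 \<le> (1::nat)"
    by simp_all
  \<comment> \<open>Taking p = \<open>Suc n\<close> and q = 1 matches the order of composition: the
    power acts first, from t' to m, and the single factor v last, from m to s'.\<close>
  then obtain m where m: "m \<in> B" "s' < m" "m < t'"
    and le: "weight_power \<mu> (Suc n + 1) (t', s') \<le> weight_power \<mu> (Suc n) (t', m) * weight_power \<mu> 1 (m, s')"
    using sub D unfolding submultiplicative_def by blast
  have A: "(t', m) \<in> Delta_at B (t, s)" "(m, s') \<in> Delta_at B (t, s)"
    and D': "(t', m) \<in> Delta B" "(m, s') \<in> Delta B" and inB: "t' \<in> B" "s' \<in> B"
    using m Suc.prems by (auto simp: Delta_at_iff Delta_def)
  note Hom = section_in_Hom[OF vh A(2)] section_in_Hom[OF wh A(1)]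
  have norms: "vnorm (Hom (E m) (E s')) (v (m, s')) \<ge> 0" "vnorm (Hom (E t') (E m)) (?w (t', m)) \<ge> 0"
    using Hom m inB complex_normed_space_pair.Hom_norm_nonneg[OF normed_fibre_pair] by blast+
  have c: "vnorm (Hom (E t') (E s')) (compose (carrier (E t')) (v (m, s')) (?w (t', m)))
      \<le> vnorm (Hom (E m) (E s')) (v (m, s')) * vnorm (Hom (E t') (E m)) (?w (t', m))"
    using Hom m inB by (intro compose_in_Hom(2) normed_fibre)
  have pos: "weight_power \<mu> (Suc n) (t', m) > 0" "weight_power \<mu> 1 (m, s') > 0"
    using weight_power_pos[OF weight] D' by simp_all
  have "weight_power \<mu> (Suc (Suc n)) (t', s') *
      vnorm (Hom (E t') (E s')) (section_power B E \<iota> (t, s) v (Suc (Suc n)) (t', s'))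
    = weight_power \<mu> (Suc n + 1) (t', s') *
      vnorm (Hom (E t') (E s')) (compose (carrier (E t')) (v (m, s')) (?w (t', m)))"
    using section_comp_eq[OF vh wh Suc.prems m] by simp
  also have "\<dots> \<le> weight_power \<mu> (Suc n + 1) (t', s') *
      (vnorm (Hom (E m) (E s')) (v (m, s')) * vnorm (Hom (E t') (E m)) (?w (t', m)))"
    using weight_power_pos[OF weight D, of "Suc n + 1"] by (intro mult_left_mono c) simp
  also have "\<dots> \<le> (weight_power \<mu> (Suc n) (t', m) * weight_power \<mu> 1 (m, s')) *
      (vnorm (Hom (E m) (E s')) (v (m, s')) * vnorm (Hom (E t') (E m)) (?w (t', m)))"
    using norms by (intro mult_right_mono le) simp
  also have "\<dots> = (weight_power \<mu> 1 (m, s') * vnorm (Hom (E m) (E s')) (v (m, s'))) *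
      (weight_power \<mu> (Suc n) (t', m) * vnorm (Hom (E t') (E m)) (?w (t', m)))"
    by (simp only: mult_ac)
  also have "\<dots> \<le> N * N ^ Suc n"
    using Suc.IH[OF A(1)] Lspace_bound[OF v A(2)] pos norms
    by (intro mult_mono') (simp_all add: N_def)
  finally show ?case
    by (simp add: N_def)
qed

text \<open>The \<open>e^n\<close> of the weight cancels against the one in the bound for
  \<open>n^n\<close>, so exactly \<open>n!\<close> remains and the ratio is |v| / \<lambda>, without
  an additional constant.\<close>

lemma section_power_norm_le:
  assumes dense: "densely_ordered B" and weight: "weight_function B \<mu>"
    and sub: "submultiplicative B \<mu>" and D: "(t, s) \<in> Delta B"
    and v: "v \<in> carrier (Lspace B E \<iota> (weight_power \<mu> 1) (t, s))"
  shows "section_power B E \<iota> (t, s) v n (t, s) \<in> carrier (Hom (E t) (E s))"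
    and "vnorm (Hom (E t) (E s)) (section_power B E \<iota> (t, s) v n (t, s))
      \<le> fact n * (vnorm (Lspace B E \<iota> (weight_power \<mu> 1) (t, s)) v / \<mu> (t, s)) ^ n"
proof -
  have A: "(t, s) \<in> Delta_at B (t, s)" and B: "t \<in> B" "s \<in> B" "s \<le> t"
    using D by (auto simp: Delta_def Delta_at_iff)
  define N where "N = vnorm (Lspace B E \<iota> (weight_power \<mu> 1) (t, s)) v"
  define w where "w = section_power B E \<iota> (t, s) v n (t, s)"
  have "w \<in> carrier (Hom (E t) (E s)) \<and> vnorm (Hom (E t) (E s)) w \<le> fact n * (N / \<mu> (t, s)) ^ n"
  proof (cases n)
    \<comment> \<open>The zeroth power is the connecting map from E_t to E_s, and the bound 1 is the
      normalisation of connecting maps.\<close>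
    case 0
    then show ?thesis
      using A B connecting connecting_norm by (simp add: w_def)
  next
    case (Suc k)
    have vh: "v \<in> horizontal_sections E \<iota> (Delta_at B (t, s))"
      using v by (simp add: Lspace_def)
    have w: "w \<in> carrier (Hom (E t) (E s))"
      using section_in_Hom[OF section_power_horizontal[OF dense vh] A] by (simp add: w_def Suc)
    have bound: "exp 1 ^ n * \<mu> (t, s) ^ n / real n ^ n * vnorm (Hom (E t) (E s)) w \<le> N ^ n"
      using section_power_bound[OF dense weight sub v A, of k]
      by (simp only: w_def N_def Suc weight_power_def)
    have \<mu>: "\<mu> (t, s) > 0"
      using weight D by (simp add: weight_function_def)
    have "real n ^ n > 0"
      using Suc by simp
    have "vnorm (Hom (E t) (E s)) w \<ge> 0"
      using w B complex_normed_space_pair.Hom_norm_nonneg[OF normed_fibre_pair] by blast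
    \<comment> \<open>\<open>Lspace\<close> has not been shown to be a normed space, so the sign is
      read off from the bound itself.\<close>
    then have "N ^ n \<ge> 0"
      using bound \<mu> by (intro order_trans[OF _ bound]) simp
    have "exp 1 ^ n * (\<mu> (t, s) ^ n * vnorm (Hom (E t) (E s)) w) \<le> real n ^ n * N ^ n"
      using bound \<open>real n ^ n > 0\<close> by (simp add: field_simps)
    also have "\<dots> \<le> exp 1 ^ n * fact n * N ^ n"
      using \<open>N ^ n \<ge> 0\<close> by (intro mult_right_mono power_self_le_exp_fact)
    finally have "\<mu> (t, s) ^ n * vnorm (Hom (E t) (E s)) w \<le> fact n * N ^ n"
      by simp
    with w \<mu> show ?thesis
      by (simp add: power_divide field_simps)
  qed
  then show "section_power B E \<iota> (t, s) v n (t, s) \<in> carrier (Hom (E t) (E s))"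
    and "vnorm (Hom (E t) (E s)) (section_power B E \<iota> (t, s) v n (t, s))
      \<le> fact n * (vnorm (Lspace B E \<iota> (weight_power \<mu> 1) (t, s)) v / \<mu> (t, s)) ^ n"
    by (simp_all add: w_def N_def)
qed

end

section \<open>The Borel map\<close>

text \<open>The domain condition |v| < R \<lambda>(t, s) says that x = |v| / \<lambda>(t, s) lies
  inside the disc of convergence, where the power series converges absolutely. The factor
  \<open>1 / n!\<close> cancels the factorial in the estimate of the n-th power, which leaves |f|(x)
  as the majorant.\<close>

lemma (in kolmogorov_space) borel_series:
  assumes dense: "densely_ordered B" and weight: "weight_function B \<mu>"
    and sub: "submultiplicative B \<mu>"
    and dom: "(t, s, v) \<in> borel_domain B E \<iota> \<mu> (fps_conv_radius f)"
  shows "\<exists>w. vsums (Hom (E t) (E s)) (borel_term B E \<iota> f (t, s, v)) w \<and> w \<in> carrier (Hom (E t) (E s)) \<and>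
    vnorm (Hom (E t) (E s)) w
      \<le> eval_fps (fps_abs f) (vnorm (Lspace B E \<iota> (weight_power \<mu> 1) (t, s)) v / \<mu> (t, s))"
proof -
  define N where "N = vnorm (Lspace B E \<iota> (weight_power \<mu> 1) (t, s)) v"
  define x where "x = N / \<mu> (t, s)"
  have D: "(t, s) \<in> Delta B" and v: "v \<in> carrier (Lspace B E \<iota> (weight_power \<mu> 1) (t, s))"
    and less: "ereal N < fps_conv_radius f * ereal (\<mu> (t, s))"
    using dom by (auto simp: borel_domain_def N_def)
  have B: "t \<in> B" "s \<in> B" and A: "(t, s) \<in> Delta_at B (t, s)"
    using D by (auto simp: Delta_def Delta_at_iff)
  interpret complex_normed_space_pair "E t" "E s"
    using B by (rule normed_fibre_pair)
  interpret H: complex_banach_space "Hom (E t) (E s)"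
    using B by (intro complex_banach_space_Hom normed_fibre banach)
  have \<mu>: "\<mu> (t, s) > 0"
    using weight D by (simp add: weight_function_def)
  have "v \<in> horizontal_sections E \<iota> (Delta_at B (t, s))"
    using v by (simp add: Lspace_def)
  \<comment> \<open>One value of the section shows that its norm is nonnegative; thus x equals its
    own absolute value in the majorant.\<close>
  then have "0 \<le> weight_power \<mu> 1 (t, s) * vnorm (Hom (E t) (E s)) (v (t, s))"
    using weight_power_pos[OF weight D, of 1] Hom_norm_nonneg[OF section_in_Hom[OF _ A]] by simp
  also have "\<dots> \<le> N"
    unfolding N_def by (rule Lspace_bound[OF v A])
  finally have "x \<ge> 0"
    using \<mu> by (simp add: x_def)
  \<comment> \<open>The radius may be infinite, so the division by the weight is carried out by
    cases on it.\<close>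
  have "ereal x < fps_conv_radius f"
    using less \<mu> by (cases "fps_conv_radius f") (auto simp: x_def field_simps)
  then have "summable (\<lambda>n. norm (fps_nth f n * complex_of_real x ^ n))"
    using \<open>x \<ge> 0\<close> by (intro abs_summable_in_conv_radius) (simp add: fps_conv_radius_def)
  then have summable: "summable (\<lambda>n. cmod (fps_nth f n) * x ^ n)"
    using \<open>x \<ge> 0\<close> by (simp add: norm_mult norm_power)
  note power = section_power_norm_le[OF dense weight sub D v]
  have "vnorm (Hom (E t) (E s)) (borel_term B E \<iota> f (t, s, v) n) \<le> cmod (fps_nth f n) * x ^ n" for n
  proof -
    have "vnorm (Hom (E t) (E s)) (borel_term B E \<iota> f (t, s, v) n)
        = cmod (fps_nth f n) / fact n * vnorm (Hom (E t) (E s)) (section_power B E \<iota> (t, s) v n (t, s))"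
      using power(1) by (simp add: borel_term_def H.vnorm_smult norm_divide del: Hom_simps)
    also have "\<dots> \<le> cmod (fps_nth f n) / fact n * (fact n * x ^ n)"
      unfolding x_def N_def by (intro mult_left_mono power(2)) simp
    finally show ?thesis
      by simp
  qed
  moreover have "range (borel_term B E \<iota> f (t, s, v)) \<subseteq> carrier (Hom (E t) (E s))"
    using power(1) by (auto simp: borel_term_def simp del: Hom_simps)
  ultimately show ?thesis
    using H.vsums_summable_bound[OF _ _ summable]
    by (simp add: eval_fps_def fps_abs_def x_def N_def)
qed

theorem theorem5p6p2:
  fixes B :: "real set"
    and E :: "real \<Rightarrow> 'a cnormed"
    and \<iota> :: "real \<Rightarrow> real \<Rightarrow> 'a \<Rightarrow> 'a"
    and lam :: "real \<times> real \<Rightarrow> real"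
    and f :: "complex fps"
    and R :: ereal
  assumes "densely_ordered B"
    and "kolmogorov_space B E \<iota>"
    and "weight_function B lam"
    and "submultiplicative B lam"
    and "fps_conv_radius f = R"
    and "R > 0"
  shows "(\<forall>(t, s, v)\<in>borel_domain B E \<iota> lam R.
            vsums (Hom (E t) (E s)) (borel_term B E \<iota> f (t, s, v))
              (snd (snd (borel_map B E \<iota> f (t, s, v))))) \<and>
         borel_map B E \<iota> f \<in> borel_domain B E \<iota> lam R \<rightarrow> Hom_bundle B E \<and>
         (\<forall>(t, s, v)\<in>borel_domain B E \<iota> lam R.
            \<exists>h. borel_map B E \<iota> f (t, s, v) = (t, s, h)) \<and>
         (\<forall>(t, s, u)\<in>borel_domain B E \<iota> lam R.
            vnorm (Hom (E t) (E s)) (snd (snd (borel_map B E \<iota> f (t, s, u))))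
              \<le> eval_fps (fps_abs f)
                  (vnorm (Lspace B E \<iota> (weight_power lam 1) (t, s)) u / lam (t, s)))"
proof -
  interpret kolmogorov_space B E \<iota> by fact
  \<comment> \<open>By uniqueness of sums the element provided by \<open>borel_series\<close> is the
    one that \<open>vsuminf\<close> selects, so its convergence, membership and estimate become
    those of the Borel map.\<close>
  have key: "vsums (Hom (E t) (E s)) (borel_term B E \<iota> f (t, s, v)) (snd (snd (borel_map B E \<iota> f (t, s, v)))) \<and>
      snd (snd (borel_map B E \<iota> f (t, s, v))) \<in> carrier (Hom (E t) (E s)) \<and>
      vnorm (Hom (E t) (E s)) (snd (snd (borel_map B E \<iota> f (t, s, v))))
        \<le> eval_fps (fps_abs f) (vnorm (Lspace B E \<iota> (weight_power lam 1) (t, s)) v / lam (t, s)) \<and>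
      (t, s) \<in> Delta B"
    if dom: "(t, s, v) \<in> borel_domain B E \<iota> lam R" for t s v
  proof -
    have D: "(t, s) \<in> Delta B" "t \<in> B" "s \<in> B"
      using dom by (auto simp: borel_domain_def Delta_def)
    then interpret H: complex_normed_space "Hom (E t) (E s)"
      by (intro complex_normed_space_pair.complex_normed_space_Hom normed_fibre_pair)
    show ?thesis
      using borel_series[OF assms(1,3,4), of t s v f] dom D H.vsums_vsuminf
      unfolding assms(5) borel_map_def by auto
  qed
  then show ?thesis
    by (auto simp: Hom_bundle_def borel_map_def)
qed

end
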